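(* Let $f=(f_1,\dots,f_n):\mathbb{R}^n\to\mathbb{R}^n$ be a real polynomial mapping which is $\mathcal{D}_0$. Then there exist univariate polynomials $v_1,\dots,v_n,w\in\mathbb{R}[t]$, with $\deg v_i<\deg w$ for $i=1,\dots,n$ and $\deg w=\#V_{\mathbb{C}}(\mathcal{I}[f,z])$, such that $$\mathrm{Sol}(f)=\big\{\big(v_1(t),\dots,v_n(t)\big): w(t)=0,\ t\in\mathbb{R}\big\}.$$
   Context: For a real polynomial mapping $f=(f_1,\dots,f_n):\mathbb{R}^n\to\mathbb{R}^n$, $\mathrm{Sol}(f)$ denotes the solution set of the polynomial complementarity problem $\mathrm{CP}(f)$, i.e. the set of $x\in\mathbb{R}^n$ with $x\ge0$, $f(x)\ge0$ (componentwise) and $\langle x\mid f(x)\rangle=0$ (usual scalar product). $f$ is called $\mathcal{D}_0$ if the set $\{x\in\mathbb{C}^n:x_1f_1(x)=\dots=x_nf_n(x)=0\}$ is finite. With $x=(x_1,\dots,x_n)$ and slack variables $z=(z_1,\dots,z_{2n})$, $\mathcal{I}[f,z]$ is the ideal of $\mathbb{R}[x,z]$ generated by the $3n$ polynomials $x_if_i$, $z_i^2-x_i$, $z_{n+i}^2-f_i$, $i=1,\dots,n$, and $V_{\mathbb{C}}(\mathcal{I}[f,z])\subseteq\mathbb{C}^{3n}$ is its set of common complex zeros. $\#$ denotes cardinality. *)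

theory Defs
  imports "HOL-Analysis.Analysis" "HOL-Library.Poly_Mapping" "HOL-Computational_Algebra.Polynomial"
begin

text \<open>Real polynomials whose variables are the elements of \<open>'v\<close>: finitely supported
  coefficient functions on the exponent vectors.\<close>

type_synonym 'v mpoly = "('v \<Rightarrow>\<^sub>0 nat) \<Rightarrow>\<^sub>0 real"

definition Const :: "real \<Rightarrow> 'v mpoly" where
  "Const c = Poly_Mapping.single 0 c"

definition Var :: "'v \<Rightarrow> 'v mpoly" where
  "Var v = Poly_Mapping.single (Poly_Mapping.single v 1) 1"

text \<open>Substitution of \<open>a v\<close> for each variable \<open>v\<close> in a commutative ring, with \<open>h\<close> mapping the
  real coefficients into that ring.  With \<open>h = of_real\<close> this is evaluation at a real or complex
  point, with \<open>h = Const\<close> it is substitution of polynomials.\<close>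

definition mpoly_subst :: "(real \<Rightarrow> 'b::comm_ring_1) \<Rightarrow> ('v::finite \<Rightarrow> 'b) \<Rightarrow> 'v mpoly \<Rightarrow> 'b" where
  "mpoly_subst h a p =
     (\<Sum>m\<in>Poly_Mapping.keys p.
        h (Poly_Mapping.lookup p m) * (\<Prod>v\<in>UNIV. a v ^ Poly_Mapping.lookup m v))"

definition mpoly_eval :: "'v mpoly \<Rightarrow> 'a::real_field ^ 'v::finite \<Rightarrow> 'a" where
  "mpoly_eval p a = mpoly_subst of_real (\<lambda>v. a $ v) p"

text \<open>A real polynomial mapping of \<open>\<real>\<^sup>n\<close> is given by its component polynomials
  \<open>f :: 'n \<Rightarrow> 'n mpoly\<close>, where \<open>n = CARD('n)\<close>.\<close>

definition poly_map :: "('n::finite \<Rightarrow> 'n mpoly) \<Rightarrow> real ^ 'n \<Rightarrow> real ^ 'n" where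
  "poly_map f x = (\<chi> i. mpoly_eval (f i) x)"

definition Sol :: "('n::finite \<Rightarrow> 'n mpoly) \<Rightarrow> (real ^ 'n) set" where
  "Sol f = {x. (\<forall>i. 0 \<le> x $ i) \<and> (\<forall>i. 0 \<le> poly_map f x $ i) \<and> x \<bullet> poly_map f x = 0}"

definition is_D0 :: "('n::finite \<Rightarrow> 'n mpoly) \<Rightarrow> bool" where
  "is_D0 f \<longleftrightarrow> finite {x :: complex ^ 'n. \<forall>i. x $ i * mpoly_eval (f i) x = 0}"

text \<open>The variables of \<open>\<real>[x,z]\<close> are indexed by \<open>'n + 'n + 'n\<close>: \<open>Inl i\<close> stands for \<open>x\<^sub>i\<close>,
  \<open>Inr (Inl i)\<close> for \<open>z\<^sub>i\<close> and \<open>Inr (Inr i)\<close> for \<open>z\<^bsub>n+i\<^esub>\<close>.\<close>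

definition xvar :: "'n \<Rightarrow> ('n + 'n + 'n) mpoly" where
  "xvar i = Var (Inl i)"

definition zvar1 :: "'n \<Rightarrow> ('n + 'n + 'n) mpoly" where
  "zvar1 i = Var (Inr (Inl i))"

definition zvar2 :: "'n \<Rightarrow> ('n + 'n + 'n) mpoly" where
  "zvar2 i = Var (Inr (Inr i))"

text \<open>The inclusion of \<open>\<real>[x]\<close> into \<open>\<real>[x,z]\<close>.\<close>

definition embed :: "'n::finite mpoly \<Rightarrow> ('n + 'n + 'n) mpoly" where
  "embed p = mpoly_subst Const xvar p"

text \<open>The ideal generated by a set is its span in the ring viewed as a module over itself.\<close>

lemma module_mult: "module ((*) :: 'a::comm_ring_1 \<Rightarrow> 'a \<Rightarrow> 'a)"
  by unfold_locales (simp_all add: algebra_simps)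

definition generated_ideal :: "'a::comm_ring_1 set \<Rightarrow> 'a set" where
  "generated_ideal B = module.span (*) B"

definition slack_ideal :: "('n::finite \<Rightarrow> 'n mpoly) \<Rightarrow> ('n + 'n + 'n) mpoly set" where
  "slack_ideal f = generated_ideal
     (range (\<lambda>i. xvar i * embed (f i)) \<union>
      range (\<lambda>i. zvar1 i ^ 2 - xvar i) \<union>
      range (\<lambda>i. zvar2 i ^ 2 - embed (f i)))"

definition complex_variety :: "'v::finite mpoly set \<Rightarrow> (complex ^ 'v) set" where
  "complex_variety I = {a. \<forall>p\<in>I. mpoly_eval p a = 0}"

end

theory Submission
  imports Defs
begin

text \<open>
  Let \<open>V \<subseteq> \<complex>\<^sup>3\<^sup>n\<close> be the variety of the slack ideal.  The equations \<open>z\<^sub>i\<^sup>2 = x\<^sub>i\<close> and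
  \<open>z\<^bsub>n+i\<^esub>\<^sup>2 = f\<^sub>i\<close> encode the sign conditions of the complementarity problem over the reals, so
  the solution set is the projection to the \<open>x\<close>-coordinates of the real points of \<open>V\<close>
  (\<open>Sol_eq_real_slack_points\<close>).  Over the finite set of the \<open>\<D>\<^sub>0\<close> hypothesis there are at most
  two choices for every slack coordinate, so \<open>V\<close> is finite; it is nonempty, since a point above
  \<open>x = 0\<close> always exists, and stable under complex conjugation.

  What remains is a fact about any such set (\<open>real_points_parametrization\<close>), the geometric
  content of the shape lemma for radical ideals.  Choose a linear form \<open>L\<close> with real coefficients
  that is injective on \<open>V\<close>.  As \<open>L\<close> commutes with conjugation, \<open>w(t) = \<Prod>\<^bsub>a \<in> V\<^esub> (t - L a)\<close>
  is a real polynomial of degree \<open>card V\<close>, and by injectivity \<open>L a\<close> is real exactly when \<open>a\<close> is.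
  Hence the real roots of \<open>w\<close> are the values \<open>L a\<close> at the real points \<open>a\<close> of \<open>V\<close>, and
  interpolation yields polynomials of degree less than \<open>card V\<close> that recover the coordinates of
  \<open>a\<close> from \<open>L a\<close>.
\<close>

section \<open>Evaluation as a ring homomorphism\<close>

lemma mpoly_subst_superset:
  assumes "finite S" "Poly_Mapping.keys p \<subseteq> S" "h 0 = 0"
  shows "mpoly_subst h a p =
    (\<Sum>m\<in>S. h (Poly_Mapping.lookup p m) * (\<Prod>v\<in>UNIV. a v ^ Poly_Mapping.lookup m v))"
  unfolding mpoly_subst_def
  by (rule sum.mono_neutral_left) (use assms in \<open>auto simp: in_keys_iff\<close>)

lemma mpoly_subst_add:
  assumes "h 0 = 0" "\<And>x y. h (x + y) = h x + h y"
  shows "mpoly_subst h a (p + q) = mpoly_subst h a p + mpoly_subst h a q"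
proof -
  let ?S = "Poly_Mapping.keys p \<union> Poly_Mapping.keys q"
  note superset = mpoly_subst_superset[where S = ?S and h = h, OF _ _ assms(1)]
  have "Poly_Mapping.keys (p + q) \<subseteq> ?S" by (rule keys_add)
  then show ?thesis
    by (subst (1 2 3) superset)
       (auto simp: lookup_add assms distrib_right sum.distrib)
qed

lemma mpoly_subst_0: "mpoly_subst h a 0 = 0"
  by (simp add: mpoly_subst_def)

lemma mpoly_subst_single:
  assumes "h 0 = 0"
  shows "mpoly_subst h a (Poly_Mapping.single m c) =
    h c * (\<Prod>v\<in>UNIV. a v ^ Poly_Mapping.lookup m v)"
  using assms by (subst mpoly_subst_superset[where S = "{m}"]) auto

lemma poly_mapping_induct_single_add:
  assumes "P 0" "\<And>m c. P (Poly_Mapping.single m c)" "\<And>p q. P p \<Longrightarrow> P q \<Longrightarrow> P (p + q)"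
  shows "P p"
proof (induction p rule: update_induct)
  case const
  show ?case by (rule assms)
next
  case (update p k c)
  have "Poly_Mapping.update k c p = Poly_Mapping.single k c + p"
    using update by (intro poly_mapping_eqI)
      (auto simp: lookup_add lookup_single lookup_update in_keys_iff when_def)
  then show ?case using update assms by metis
qed

lemma mpoly_subst_mult:
  assumes h: "h 0 = 0" "\<And>x y. h (x + y) = h x + h y" "\<And>x y. h (x * y) = h x * h y"
  shows "mpoly_subst h a (p * q) = mpoly_subst h a p * mpoly_subst h a q"
proof -
  note add = mpoly_subst_add[where h = h, OF h(1,2)]
  have "mpoly_subst h a (Poly_Mapping.single m c * q) =
      mpoly_subst h a (Poly_Mapping.single m c) * mpoly_subst h a q" for m c
    by (induction q rule: poly_mapping_induct_single_add)
       (simp_all add: add distrib_left mult_single mpoly_subst_0 mpoly_subst_single h lookup_add power_add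
          prod.distrib algebra_simps)
  then show ?thesis
    by (induction p rule: poly_mapping_induct_single_add) (simp_all add: add mpoly_subst_0 distrib_right)
qed

lemma mpoly_eval_add: "mpoly_eval (p + q) a = mpoly_eval p a + mpoly_eval q a"
  unfolding mpoly_eval_def by (rule mpoly_subst_add) simp_all

lemma mpoly_eval_mult: "mpoly_eval (p * q) a = mpoly_eval p a * mpoly_eval q a"
  unfolding mpoly_eval_def by (rule mpoly_subst_mult) simp_all

lemma mpoly_eval_Const: "mpoly_eval (Const c) a = of_real c"
  unfolding mpoly_eval_def Const_def by (simp add: mpoly_subst_single)

lemma mpoly_eval_Var: "mpoly_eval (Var v) a = a $ v"
proof -
  have "(\<Prod>u\<in>UNIV. (a $ u) ^ Poly_Mapping.lookup (Poly_Mapping.single v (1::nat)) u) =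
      (\<Prod>u\<in>UNIV. if u = v then a $ u else 1)"
    by (rule prod.cong) (auto simp: lookup_single when_def)
  then show ?thesis
    unfolding mpoly_eval_def Var_def by (simp add: mpoly_subst_single)
qed

lemma mpoly_eval_0: "mpoly_eval 0 a = 0"
  by (simp add: mpoly_eval_def mpoly_subst_0)

lemma mpoly_eval_1: "mpoly_eval 1 a = 1"
  using mpoly_eval_Const[of 1 a] by (simp add: Const_def)

lemma mpoly_eval_diff: "mpoly_eval (p - q) a = mpoly_eval p a - mpoly_eval q a"
  using mpoly_eval_add[of "p - q" q a] by simp

lemma mpoly_eval_sum: "mpoly_eval (sum g A) a = (\<Sum>x\<in>A. mpoly_eval (g x) a)"
  by (induction A rule: infinite_finite_induct) (simp_all add: mpoly_eval_0 mpoly_eval_add)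

lemma mpoly_eval_prod: "mpoly_eval (prod g A) a = (\<Prod>x\<in>A. mpoly_eval (g x) a)"
  by (induction A rule: infinite_finite_induct) (simp_all add: mpoly_eval_1 mpoly_eval_mult)

lemma mpoly_eval_power: "mpoly_eval (p ^ k) a = mpoly_eval p a ^ k"
  by (induction k) (simp_all add: mpoly_eval_1 mpoly_eval_mult)

lemma mpoly_eval_embed: "mpoly_eval (embed p) a = mpoly_eval p (\<chi> i. a $ Inl i)"
  unfolding embed_def mpoly_subst_def mpoly_eval_sum mpoly_eval_mult mpoly_eval_prod
    mpoly_eval_power mpoly_eval_Const xvar_def mpoly_eval_Var
  by (simp add: mpoly_eval_def mpoly_subst_def)

lemma mpoly_eval_cnj: "mpoly_eval p (\<chi> v. cnj (a $ v)) = cnj (mpoly_eval p a)"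
  by (simp add: mpoly_eval_def mpoly_subst_def)

lemma mpoly_eval_of_real:
  "mpoly_eval p (\<chi> v. complex_of_real (a $ v)) = complex_of_real (mpoly_eval p a)"
  by (simp add: mpoly_eval_def mpoly_subst_def)

section \<open>The slack variety\<close>

text \<open>The polynomials vanishing at a given point form an ideal, so vanishing of the generators is
  enough.\<close>

lemma complex_variety_generated_ideal:
  "complex_variety (generated_ideal B) = complex_variety B"
proof -
  interpret module "(*) :: 'a mpoly \<Rightarrow> 'a mpoly \<Rightarrow> 'a mpoly" by (rule module_mult)
  have "subspace {p. mpoly_eval p a = 0}" for a :: "complex ^ 'a"
    by (auto simp: subspace_def mpoly_eval_0 mpoly_eval_add mpoly_eval_mult)
  then have "span B \<subseteq> {p. mpoly_eval p a = 0}" if "B \<subseteq> {p. mpoly_eval p a = 0}" for a :: "complex ^ 'a"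
    using that by (intro span_minimal)
  then show ?thesis
    unfolding complex_variety_def generated_ideal_def using span_base[of _ B] by blast
qed

lemma slack_variety_iff:
  "a \<in> complex_variety (slack_ideal f) \<longleftrightarrow>
    (\<forall>i. a $ Inl i * mpoly_eval (f i) (\<chi> j. a $ Inl j) = 0 \<and>
         (a $ Inr (Inl i))\<^sup>2 = a $ Inl i \<and>
         (a $ Inr (Inr i))\<^sup>2 = mpoly_eval (f i) (\<chi> j. a $ Inl j))"
  unfolding slack_ideal_def complex_variety_generated_ideal
  by (auto simp: complex_variety_def mpoly_eval_mult mpoly_eval_diff mpoly_eval_power
        mpoly_eval_embed mpoly_eval_Var xvar_def zvar1_def zvar2_def ball_Un all_conj_distrib)

lemma finite_complex_square_preimage:
  assumes "finite S"
  shows "finite {z :: complex. z\<^sup>2 \<in> S}"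
proof -
  have "{z :: complex. z\<^sup>2 \<in> S} \<subseteq> csqrt ` S \<union> uminus ` csqrt ` S"
  proof
    fix z :: complex assume z: "z \<in> {z. z\<^sup>2 \<in> S}"
    have "z\<^sup>2 = (csqrt (z\<^sup>2))\<^sup>2" by simp
    then have "z = csqrt (z\<^sup>2) \<or> z = - csqrt (z\<^sup>2)" unfolding power2_eq_iff .
    with z show "z \<in> csqrt ` S \<union> uminus ` csqrt ` S" by blast
  qed
  then show ?thesis by (rule finite_subset) (use assms in simp)
qed

text \<open>Every coordinate of a point of the variety is an \<open>x\<close>-coordinate of one of the finitely many
  points in the definition of \<open>\<D>\<^sub>0\<close>, or a square root of such a coordinate or of a value of some
  \<open>f\<^sub>i\<close> at such a point.  Hence all coordinates lie in one finite set.\<close>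

lemma finite_slack_variety:
  assumes "is_D0 f"
  shows "finite (complex_variety (slack_ideal f))"
proof -
  define X where "X = {x :: complex ^ 'a. \<forall>i. x $ i * mpoly_eval (f i) x = 0}"
  have "finite X" using assms by (simp add: is_D0_def X_def)
  define S where "S = (\<lambda>(x, i). x $ i) ` (X \<times> UNIV) \<union> (\<lambda>(x, i). mpoly_eval (f i) x) ` (X \<times> UNIV)"
  define T where "T = S \<union> {z. z\<^sup>2 \<in> S}"
  have "finite S" using \<open>finite X\<close> by (simp add: S_def)
  then have "finite T" by (simp add: T_def finite_complex_square_preimage)
  then have "finite (vec_lambda ` (UNIV \<rightarrow>\<^sub>E T) :: (complex ^ ('a + 'a + 'a)) set)"
    by (intro finite_imageI finite_PiE) auto
  moreover have "a \<in> vec_lambda ` (UNIV \<rightarrow>\<^sub>E T)" if "a \<in> complex_variety (slack_ideal f)" for a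
  proof -
    have a: "(\<chi> j. a $ Inl j) \<in> X" "\<And>i. (a $ Inr (Inl i))\<^sup>2 = a $ Inl i"
      "\<And>i. (a $ Inr (Inr i))\<^sup>2 = mpoly_eval (f i) (\<chi> j. a $ Inl j)"
      using that unfolding slack_variety_iff X_def by auto
    have S: "a $ Inl i \<in> S" "mpoly_eval (f i) (\<chi> j. a $ Inl j) \<in> S" for i
      using a(1) by (force simp: S_def)+
    have "a $ v \<in> T" for v
    proof (cases v)
      case (Inl i)
      then show ?thesis using S by (simp add: T_def)
    next
      case (Inr u)
      then show ?thesis using S a(2,3) by (cases u) (simp_all add: T_def)
    qed
    then show ?thesis by (intro image_eqI[of _ _ "vec_nth a"]) auto
  qed
  ultimately show ?thesis by (meson finite_subset subsetI)
qed

text \<open>The point \<open>x = 0\<close> satisfies \<open>x\<^sub>i f\<^sub>i(x) = 0\<close> for every \<open>f\<close>.  Without a point in the variety the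
  strict degree bounds would be impossible.\<close>

lemma slack_variety_nonempty: "complex_variety (slack_ideal f) \<noteq> {}"
proof -
  let ?a = "\<chi> v. case v of Inl i \<Rightarrow> 0 | Inr (Inl i) \<Rightarrow> 0 | Inr (Inr i) \<Rightarrow> csqrt (mpoly_eval (f i) 0)"
  have "?a \<in> complex_variety (slack_ideal f)"
    unfolding slack_variety_iff by (simp add: zero_vec_def)
  then show ?thesis by blast
qed

lemma complex_variety_cnj:
  "a \<in> complex_variety I \<Longrightarrow> (\<chi> v. cnj (a $ v)) \<in> complex_variety I"
  by (simp add: complex_variety_def mpoly_eval_cnj)

section \<open>Solutions as real points of the slack variety\<close>

lemma Sol_iff: "x \<in> Sol f \<longleftrightarrow> (\<forall>i. 0 \<le> x $ i \<and> 0 \<le> mpoly_eval (f i) x \<and> x $ i * mpoly_eval (f i) x = 0)"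
proof -
  have "(\<Sum>i\<in>UNIV. x $ i * mpoly_eval (f i) x) = 0 \<longleftrightarrow> (\<forall>i. x $ i * mpoly_eval (f i) x = 0)"
    if "\<forall>i. 0 \<le> x $ i" "\<forall>i. 0 \<le> mpoly_eval (f i) x"
    using that by (subst sum_nonneg_eq_0_iff) auto
  then show ?thesis
    by (auto simp: Sol_def poly_map_def inner_vec_def)
qed

text \<open>A real number is nonnegative exactly when it is the square of a real number, so real
  slack coordinates exist above \<open>x\<close> if and only if \<open>x \<ge> 0\<close> and \<open>f(x) \<ge> 0\<close>.\<close>

lemma Sol_eq_real_slack_points:
  "Sol f = {(\<chi> i. a $ Inl i) | a :: real ^ _.
     (\<chi> v. complex_of_real (a $ v)) \<in> complex_variety (slack_ideal f)}"
proof -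
  have real_slack: "(\<chi> v. complex_of_real (a $ v)) \<in> complex_variety (slack_ideal f) \<longleftrightarrow>
      (\<forall>i. a $ Inl i * mpoly_eval (f i) (\<chi> j. a $ Inl j) = 0 \<and>
         (a $ Inr (Inl i))\<^sup>2 = a $ Inl i \<and>
         (a $ Inr (Inr i))\<^sup>2 = mpoly_eval (f i) (\<chi> j. a $ Inl j))" for a :: "real ^ _"
    unfolding slack_variety_iff
    using mpoly_eval_of_real[of _ "\<chi> j. a $ Inl j"]
    by (simp flip: of_real_power of_real_mult)
  show ?thesis
  proof (intro set_eqI iffI)
    fix x assume x: "x \<in> Sol f"
    let ?a = "\<chi> v. case v of Inl i \<Rightarrow> x $ i | Inr (Inl i) \<Rightarrow> sqrt (x $ i)
      | Inr (Inr i) \<Rightarrow> sqrt (mpoly_eval (f i) x)"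
    have "(\<chi> j. ?a $ Inl j) = x" by (simp add: vec_eq_iff)
    moreover from this have "(\<chi> v. complex_of_real (?a $ v)) \<in> complex_variety (slack_ideal f)"
      unfolding real_slack using x by (simp add: Sol_iff)
    ultimately show "x \<in> {(\<chi> i. a $ Inl i) | a :: real ^ _.
        (\<chi> v. complex_of_real (a $ v)) \<in> complex_variety (slack_ideal f)}"
      by (intro CollectI exI[of _ ?a]) simp
  next
    fix x assume "x \<in> {(\<chi> i. a $ Inl i) | a :: real ^ _.
        (\<chi> v. complex_of_real (a $ v)) \<in> complex_variety (slack_ideal f)}"
    then obtain a where a: "x = (\<chi> i. a $ Inl i)"
      "(\<chi> v. complex_of_real (a $ v)) \<in> complex_variety (slack_ideal f)" by blast
    show "x \<in> Sol f"
      unfolding Sol_iff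
    proof
      fix i
      have "x $ i * mpoly_eval (f i) x = 0" "(a $ Inr (Inl i))\<^sup>2 = x $ i"
        "(a $ Inr (Inr i))\<^sup>2 = mpoly_eval (f i) x"
        using a(2) unfolding real_slack by (auto simp: a(1))
      then show "0 \<le> x $ i \<and> 0 \<le> mpoly_eval (f i) x \<and> x $ i * mpoly_eval (f i) x = 0"
        by (metis zero_le_power2)
    qed
  qed
qed

section \<open>Univariate parametrization of the real points of a finite set\<close>

text \<open>For \<open>a \<noteq> b\<close> in \<open>V\<close>, the real coefficient vectors whose form does not separate \<open>a\<close> from \<open>b\<close> lie in
  the hyperplane orthogonal to the real or to the imaginary part of \<open>a - b\<close>, one of which is
  nonzero.  Finitely many hyperplanes have measure zero and so do not cover the space.\<close>

lemma exists_real_separating_form: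
  fixes V :: "(complex ^ 'v::finite) set"
  assumes "finite V"
  shows "\<exists>c :: real ^ 'v. inj_on (\<lambda>a. \<Sum>v\<in>UNIV. of_real (c $ v) * a $ v) V"
proof -
  define bad where "bad = (\<lambda>d :: complex ^ 'v. {c :: real ^ 'v. (\<Sum>v\<in>UNIV. of_real (c $ v) * d $ v) = 0})"
  define D where "D = (\<lambda>(a, b). a - b) ` (V \<times> V) - {0}"
  have "negligible (bad d)" if "d \<noteq> 0" for d
  proof -
    have "Re (\<Sum>v\<in>UNIV. of_real (c $ v) * d $ v) = (\<chi> v. Re (d $ v)) \<bullet> c"
      "Im (\<Sum>v\<in>UNIV. of_real (c $ v) * d $ v) = (\<chi> v. Im (d $ v)) \<bullet> c" for c :: "real ^ 'v"
      by (simp_all add: inner_vec_def mult.commute)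
    then have "bad d \<subseteq> {c. (\<chi> v. Re (d $ v)) \<bullet> c = 0}" "bad d \<subseteq> {c. (\<chi> v. Im (d $ v)) \<bullet> c = 0}"
      by (auto simp: bad_def simp flip: Re_sum Im_sum) (metis zero_complex.sel)+
    moreover have "(\<chi> v. Re (d $ v)) \<noteq> 0 \<or> (\<chi> v. Im (d $ v)) \<noteq> 0"
      using that by (auto simp: vec_eq_iff complex_eq_iff)
    ultimately show ?thesis
      by (metis negligible_hyperplane negligible_subset)
  qed
  then have "negligible (\<Union> (bad ` D))"
    using assms by (intro negligible_Union) (auto simp: D_def)
  then obtain c where c: "c \<notin> \<Union> (bad ` D)"
    using non_negligible_UNIV by (metis UNIV_eq_I)
  have "inj_on (\<lambda>a. \<Sum>v\<in>UNIV. of_real (c $ v) * a $ v) V"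
  proof (rule inj_onI, rule ccontr)
    fix a b
    assume ab: "a \<in> V" "b \<in> V" "a \<noteq> b"
      and "(\<Sum>v\<in>UNIV. of_real (c $ v) * a $ v) = (\<Sum>v\<in>UNIV. of_real (c $ v) * b $ v)"
    then have "c \<in> bad (a - b)"
      by (simp add: bad_def right_diff_distrib sum_subtractf)
    moreover have "a - b \<in> D" using ab by (force simp: D_def)
    ultimately show False using c by blast
  qed
  then show ?thesis by blast
qed

text \<open>Newton's scheme: a node \<open>s\<close> is added by correcting with a multiple of the polynomial \<open>q\<close> that
  vanishes at the earlier nodes.\<close>

lemma polynomial_interpolation:
  fixes g :: "'a::field \<Rightarrow> 'a"
  assumes "finite S" "S \<noteq> {}"
  shows "\<exists>p. degree p < card S \<and> (\<forall>s\<in>S. poly p s = g s)"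
  using assms
proof (induction S rule: finite_ne_induct)
  case (singleton s)
  show ?case by (intro exI[of _ "[:g s:]"]) simp
next
  case (insert s S)
  then obtain p where p: "degree p < card S" "\<And>u. u \<in> S \<Longrightarrow> poly p u = g u" by blast
  define q where "q = (\<Prod>u\<in>S. [:-u, 1:])"
  have q: "poly q u = 0 \<longleftrightarrow> u \<in> S" for u
    using insert by (simp add: q_def poly_prod)
  have "degree q = card S"
    by (simp add: q_def degree_prod_sum_eq)
  then have "degree (p + smult ((g s - poly p s) / poly q s) q) < card (insert s S)"
    using p(1) insert by (simp add: degree_add_less)
  moreover have "poly (p + smult ((g s - poly p s) / poly q s) q) u = g u" if "u \<in> insert s S" for u
    using that p(2) q insert by auto
  ultimately show ?case by blast
qed

text \<open>Taking real parts of the coefficients is how the complex polynomials below are made real: at a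
  real argument this takes the real part of the value.\<close>

lemma poly_map_poly_Re: "poly (map_poly Re p) t = Re (poly p (complex_of_real t))"
  by (induction p) (simp_all add: map_poly_pCons)

lemma degree_map_poly_Re_le: "degree (map_poly Re p) \<le> degree p"
  by (rule degree_le) (simp add: coeff_map_poly coeff_eq_0)

text \<open>The product of the factors \<open>t - z\<close> is invariant under conjugation of the roots, so its values at
  real \<open>t\<close> are real and replacing the coefficients by their real parts changes none of them.\<close>

lemma real_poly_of_cnj_closed_roots:
  assumes "finite Z" "cnj ` Z = Z"
  shows "\<exists>w :: real poly. degree w = card Z \<and> (\<forall>t. poly w t = 0 \<longleftrightarrow> complex_of_real t \<in> Z)"
proof -
  define W where "W = (\<Prod>z\<in>Z. [:-z, 1:])"
  have W0: "poly W z = 0 \<longleftrightarrow> z \<in> Z" for z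
    using assms(1) by (simp add: W_def poly_prod)
  have W_real: "cnj (poly W (complex_of_real t)) = poly W (complex_of_real t)" for t
  proof -
    have "cnj (poly W (complex_of_real t)) = (\<Prod>z\<in>Z. complex_of_real t - cnj z)"
      by (simp add: W_def poly_prod)
    also have "\<dots> = (\<Prod>z\<in>cnj ` Z. complex_of_real t - z)"
      by (subst prod.reindex) (auto simp: inj_on_def)
    also have "\<dots> = poly W (complex_of_real t)"
      by (simp add: assms(2)) (simp add: W_def poly_prod)
    finally show ?thesis .
  qed
  have degW: "degree W = card Z"
    by (simp add: W_def degree_prod_sum_eq)
  have "lead_coeff W = 1"
    by (simp add: W_def lead_coeff_prod)
  then have "coeff (map_poly Re W) (card Z) = 1"
    by (simp add: coeff_map_poly degW)
  then have "card Z \<le> degree (map_poly Re W)"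
    by (intro le_degree) simp
  moreover have "degree (map_poly Re W) \<le> card Z"
    using degree_map_poly_Re_le[of W] degW by simp
  ultimately have "degree (map_poly Re W) = card Z" by simp
  moreover have "poly (map_poly Re W) t = 0 \<longleftrightarrow> complex_of_real t \<in> Z" for t
    using W_real[of t] by (simp add: poly_map_poly_Re complex_eq_iff flip: W0)
  ultimately show ?thesis by blast
qed

text \<open>The interpolating polynomials \<open>P v\<close> may be replaced by their coefficientwise real parts
  because only real arguments and real points matter: there the values are the real
  parts of the coordinates, which are the coordinates themselves.\<close>

lemma real_points_parametrization:
  fixes V :: "(complex ^ 'v::finite) set"
  assumes "finite V" "V \<noteq> {}" and cnj: "\<And>a. a \<in> V \<Longrightarrow> (\<chi> v. cnj (a $ v)) \<in> V"
  shows "\<exists>(p :: 'v \<Rightarrow> real poly) (w :: real poly).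
    (\<forall>v. degree (p v) < degree w) \<and> degree w = card V \<and>
    {a. (\<chi> v. complex_of_real (a $ v)) \<in> V} = {(\<chi> v. poly (p v) t) | t. poly w t = 0}"
proof -
  let ?conj = "\<lambda>a :: complex ^ 'v. \<chi> v. cnj (a $ v)"
  obtain c :: "real ^ 'v" where "inj_on (\<lambda>a. \<Sum>v\<in>UNIV. of_real (c $ v) * a $ v) V"
    using exists_real_separating_form[OF assms(1)] by blast
  moreover define L where "L = (\<lambda>a :: complex ^ 'v. \<Sum>v\<in>UNIV. of_real (c $ v) * a $ v)"
  ultimately have inj: "inj_on L V" and L: "L a = (\<Sum>v\<in>UNIV. of_real (c $ v) * a $ v)" for a
    by simp_all
  have L_cnj: "L (?conj a) = cnj (L a)" for a by (simp add: L)
  have card: "card (L ` V) = card V" by (rule card_image[OF inj])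
  have "cnj ` L ` V \<subseteq> L ` V"
    using cnj by (auto simp flip: L_cnj)
  moreover from this have "cnj ` cnj ` L ` V \<subseteq> cnj ` L ` V" by (rule image_mono)
  ultimately have "cnj ` L ` V = L ` V" by (auto simp: image_image)
  then obtain w where w: "degree w = card V" "\<And>t. poly w t = 0 \<longleftrightarrow> complex_of_real t \<in> L ` V"
    using real_poly_of_cnj_closed_roots[of "L ` V"] assms(1) card by auto
  have "\<exists>p. degree p < card V \<and> (\<forall>a\<in>V. poly p (L a) = a $ v)" for v
    using polynomial_interpolation[of "L ` V" "\<lambda>z. inv_into V L z $ v"] assms(1,2)
    by (simp add: card inv_into_f_f[OF inj])
  then obtain P where P: "\<And>v. degree (P v) < card V" "\<And>v a. a \<in> V \<Longrightarrow> poly (P v) (L a) = a $ v"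
    by metis
  define p where "p v = map_poly Re (P v)" for v
  have "degree (p v) < degree w" for v
    using degree_map_poly_Re_le[of "P v"] P(1)[of v] w(1) by (simp add: p_def)
  have p: "poly (p v) t = Re (a $ v)" if "a \<in> V" "L a = complex_of_real t" for v t a
    using P(2)[OF that(1), of v] that(2) by (simp add: p_def poly_map_poly_Re)
  have "{a. (\<chi> v. complex_of_real (a $ v)) \<in> V} = {(\<chi> v. poly (p v) t) | t. poly w t = 0}"
  proof (intro set_eqI iffI)
    fix a :: "real ^ 'v" assume "a \<in> {a. (\<chi> v. complex_of_real (a $ v)) \<in> V}"
    then have a: "(\<chi> v. complex_of_real (a $ v)) \<in> V" by simp
    define t where "t = (\<Sum>v\<in>UNIV. c $ v * a $ v)"
    have t: "L (\<chi> v. complex_of_real (a $ v)) = complex_of_real t" by (simp add: L t_def)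
    have "poly w t = 0" using a t by (metis imageI w(2))
    moreover have "a = (\<chi> v. poly (p v) t)" using p[OF a t] by (simp add: vec_eq_iff)
    ultimately show "a \<in> {(\<chi> v. poly (p v) t) | t. poly w t = 0}" by blast
  next
    fix a assume "a \<in> {(\<chi> v. poly (p v) t) | t. poly w t = 0}"
    then obtain t b where a: "a = (\<chi> v. poly (p v) t)" and b: "b \<in> V" "L b = complex_of_real t"
      unfolding w(2) by force
    \<comment> \<open>A point with a real value under the separating form is itself real, because its
      conjugate takes the same value.\<close>
    have "?conj b = b"
      using inj_onD[OF inj _ cnj[OF b(1)] b(1)] L_cnj[of b] b(2) by simp
    then have "cnj (b $ v) = b $ v" for v by (metis vec_lambda_beta)
    then have "(\<chi> v. complex_of_real (a $ v)) = b"
      by (simp add: a p[OF b] vec_eq_iff complex_eq_iff)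
    with b(1) show "a \<in> {a. (\<chi> v. complex_of_real (a $ v)) \<in> V}" by simp
  qed
  with \<open>\<And>v. degree (p v) < degree w\<close> w(1) show ?thesis by blast
qed

theorem theorem4p2:
  fixes f :: "'n::finite \<Rightarrow> 'n mpoly"
  assumes "is_D0 f"
  shows "\<exists>(v :: 'n \<Rightarrow> real poly) (w :: real poly).
           (\<forall>i. degree (v i) < degree w) \<and>
           finite (complex_variety (slack_ideal f)) \<and>
           degree w = card (complex_variety (slack_ideal f)) \<and>
           Sol f = {(\<chi> i. poly (v i) t) | t. poly w t = 0}"
proof -
  let ?V = "complex_variety (slack_ideal f)"
  have fin: "finite ?V" by (rule finite_slack_variety[OF assms])
  have "\<exists>(p :: 'n + 'n + 'n \<Rightarrow> real poly) w. (\<forall>v. degree (p v) < degree w) \<and> degree w = card ?V \<and>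
      {a. (\<chi> v. complex_of_real (a $ v)) \<in> ?V} = {(\<chi> v. poly (p v) t) | t. poly w t = 0}"
    by (rule real_points_parametrization[OF fin slack_variety_nonempty])
      (rule complex_variety_cnj)
  then obtain p :: "'n + 'n + 'n \<Rightarrow> real poly" and w
    where deg: "\<forall>v. degree (p v) < degree w" "degree w = card ?V"
      and pts: "{a. (\<chi> v. complex_of_real (a $ v)) \<in> ?V} = {(\<chi> v. poly (p v) t) | t. poly w t = 0}"
    by (elim exE conjE) (rule that)
  have "Sol f = (\<lambda>a. \<chi> i. a $ Inl i) ` {a. (\<chi> v. complex_of_real (a $ v)) \<in> ?V}"
    unfolding Sol_eq_real_slack_points by (rule setcompr_eq_image)
  also have "\<dots> = {(\<chi> i. poly (p (Inl i)) t) | t. poly w t = 0}"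
    unfolding pts by (simp add: image_Collect) (simp add: setcompr_eq_image image_image)
  finally show ?thesis
    using deg fin by (intro exI[of _ "\<lambda>i. p (Inl i)"] exI[of _ w]) simp
qed

end
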